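(* Every $5$-distance set in $\mathbb{R}^3$ with at least $20$ points contains a subset with exactly $8$ points that is an $s$-distance set for some $s \le 4$.
   Context: For $X \subset \mathbb{R}^d$ let $A(X) = \{ d(x,y) \mid x,y \in X,\ x \neq y\}$, where $d(x,y)$ is the Euclidean distance. A set $X$ is called an $s$-distance set if $|A(X)| = s$. *)

theory Defs
  imports "HOL-Analysis.Analysis"
begin

definition distances :: "(real ^ 'n) set \<Rightarrow> real set" where
  "distances X = {dist x y | x y. x \<in> X \<and> y \<in> X \<and> x \<noteq> y}"

(* finiteness is needed because card is 0 on infinite sets *)
definition s_distance_set :: "nat \<Rightarrow> (real ^ 'n) set \<Rightarrow> bool" where
  "s_distance_set s X \<longleftrightarrow> finite (distances X) \<and> card (distances X) = s"

end

theory Submission imports Defs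
begin

text \<open>
  Choose 20 points and let D be the largest distance among them. A set of eight points with no two
  at distance D has at most four distances, so it suffices to find eight independent vertices in
  the diameter graph, whose edges are the pairs at distance D.

  The geometric input is a theorem of Dol'nikov: any two odd cycles of a diameter graph in
  \<open>\<real>\<^sup>3\<close> share a vertex (\<open>odd_closed_walks_in_diameter_graph_meet\<close>). If the graph has an odd
  closed walk of length at most five, deleting its at most five vertices therefore destroys all odd
  closed walks. What is left is bipartite with at least 15 vertices, and one side has at least
  eight. If there is no such short walk, the graph has no triangle and no closed walk of length
  five, and geometry is no longer needed: every graph of that kind on 20 vertices has eight
  independent vertices (\<open>indep_bound_20\<close>).

  Dol'nikov's theorem is proved on the sphere of directions, after an idea of Swanepoel. Scale the
  diameter to 1. The directions of the edges at a vertex x span a cone, and cones at different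
  vertices do not meet. The cone at x and the negative of the cone at another vertex y meet only
  along a common edge xy. Taking the edge vectors of an odd closed walk with alternating signs
  gives a polygon from a vector \<open>p\<close> to \<open>- p\<close>, each of whose sides lies, up to sign, in the
  cone at a vertex of the walk. For two disjoint odd walks no vector of one polygon is parallel to a
  vector of the other. But two paths that each end at the negative of their starting point must
  contain parallel vectors (\<open>antipodal_paths_meet\<close>); on the projective plane, this says that two
  noncontractible loops meet.
\<close>

section \<open>Paths between antipodal points\<close>

lemma logarithm_of_constant_constant:
  fixes h :: "real \<Rightarrow> complex"
  assumes "continuous_on {0..1} h" and exp: "\<And>t. t \<in> {0..1} \<Longrightarrow> exp (h t) = c"
  shows "h 0 = h 1"
proof -
  have "h constant_on {0..1}"
  proof (rule continuous_discrete_range_constant)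
    fix x :: real assume x: "x \<in> {0..1}"
    have "1 \<le> norm (h y - h x)" if y: "y \<in> {0..1}" "h y \<noteq> h x" for y
    proof -
      have "exp (h y) = exp (h x)" using exp x y by simp
      then obtain n :: int where n: "h y = h x + (of_int (2 * n) * pi) * \<i>"
        unfolding exp_eq by blast
      with y have "n \<noteq> 0" by auto
      then have "1 \<le> \<bar>real_of_int n\<bar>" by linarith
      moreover have "norm (h y - h x) = 2 * \<bar>real_of_int n\<bar> * pi"
        using n by (simp add: norm_mult)
      moreover have "1 \<le> 2 * pi" using pi_ge_two by linarith
      ultimately show ?thesis
        using mult_mono[of 1 "\<bar>real_of_int n\<bar>" 1 "2 * pi"] by (simp add: mult_ac)
    qed
    then show "\<exists>e>0. \<forall>y. y \<in> {0..1} \<and> h y \<noteq> h x \<longrightarrow> e \<le> norm (h y - h x)"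
      by (intro exI[of _ 1]) auto
  qed (use assms in auto)
  then show ?thesis by (auto simp: constant_on_def)
qed

text \<open>Together with \<open>u\<close>, the vectors \<open>N \<times> u\<close> and \<open>u \<times> (N \<times> u)\<close> form an orthogonal frame, so the
  two inner products are the coordinates of the projection of \<open>d\<close> along \<open>u\<close>.\<close>
lemma orthogonal_frame_kernel:
  fixes N u d :: "real^3"
  assumes "cross3 N u \<noteq> 0" "cross3 N u \<bullet> d = 0" "cross3 u (cross3 N u) \<bullet> d = 0"
  shows "cross3 u d = 0"
proof -
  define e where "e = cross3 N u"
  have "e \<bullet> u = 0" by (simp add: e_def dot_cross_self)
  then have "(e \<bullet> e) *\<^sub>R u = cross3 e (cross3 u e)"
    by (simp add: Lagrange[of e u e])
  then have "(e \<bullet> e) *\<^sub>R cross3 d u = cross3 d (cross3 e (cross3 u e))"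
    by (metis cross_mult_right)
  also have "\<dots> = 0"
    using assms(2,3) by (simp add: Lagrange[of d e] inner_commute flip: e_def)
  finally have "cross3 d u = 0" using assms(1) by (simp add: e_def)
  then show ?thesis by (metis cross_skew neg_equal_0_iff_equal)
qed

text \<open>Project the path \<open>d\<close> along the direction \<open>g s\<close>. If no two vectors are parallel, the projection
  avoids the origin, and since \<open>d\<close> ends at minus its start, it turns by an odd multiple of \<open>\<pi>\<close>.
  By continuity this angle does not depend on \<open>s\<close>. On the other hand, \<open>g 1 = - g 0\<close> means that
  the last projection is a mirror image of the first, so the angle also changes sign; but an odd
  multiple of \<open>\<pi>\<close> is not its own negative. The vector \<open>N\<close> serves to choose coordinates in the
  planes orthogonal to \<open>g s\<close> continuously in \<open>s\<close>.\<close>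
lemma antipodal_paths_meet:
  fixes g d :: "real \<Rightarrow> real^3"
  assumes "path g" "pathfinish g = - pathstart g"
    and "path d" "pathfinish d = - pathstart d"
    and N: "\<And>z. z \<in> path_image g \<Longrightarrow> cross3 N z \<noteq> 0"
  obtains z w where "z \<in> path_image g" "w \<in> path_image d" "cross3 z w = 0"
proof (rule ccontr)
  assume "\<not> thesis"
  with that have indep: "cross3 z w \<noteq> 0" if "z \<in> path_image g" "w \<in> path_image d" for z w
    using that by blast
  define F where "F = (\<lambda>(s, t). Complex (cross3 N (g s) \<bullet> d t) (cross3 (g s) (cross3 N (g s)) \<bullet> d t))"
  define Q :: "(real \<times> real) set" where "Q = {0..1} \<times> {0..1}"
  have g: "continuous_on Q (\<lambda>p. g (fst p))"
    by (rule continuous_on_compose2[of "{0..1}" g])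
       (use assms in \<open>auto simp: path_def Q_def intro!: continuous_intros\<close>)
  have d: "continuous_on Q (\<lambda>p. d (snd p))"
    by (rule continuous_on_compose2[of "{0..1}" d])
       (use assms in \<open>auto simp: path_def Q_def intro!: continuous_intros\<close>)
  have contF: "continuous_on Q F"
    unfolding F_def case_prod_beta Complex_eq
    by (intro continuous_intros continuous_on_cross g d)
  have F0: "F p \<noteq> 0" if "p \<in> Q" for p
  proof
    assume "F p = 0"
    obtain s t where p: "p = (s, t)" by force
    have st: "g s \<in> path_image g" "d t \<in> path_image d"
      using that by (auto simp: p Q_def path_image_def)
    have "cross3 (g s) (d t) = 0"
      using \<open>F p = 0\<close> N[OF st(1)] unfolding F_def p
      by (intro orthogonal_frame_kernel[of N]) (auto simp: complex_eq_iff)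
    with indep st show False by blast
  qed
  have "contractible Q" unfolding Q_def
    by (intro convex_imp_contractible convex_Times) auto
  then obtain G where G: "continuous_on Q G" "\<And>p. p \<in> Q \<Longrightarrow> F p = exp (G p)"
    using continuous_logarithm_on_contractible[OF contF] F0 by blast
  have gd: "g 1 = - g 0" "d 1 = - d 0"
    using assms by (auto simp: pathfinish_def pathstart_def)
  have F1: "F (s, 1) = - F (s, 0)" for s
    by (simp add: F_def gd complex_eq_iff)
  \<comment> \<open>Replacing \<open>g s\<close> by its negative changes the sign of the first frame vector but not of the
      second, which is quadratic in \<open>g s\<close>.\<close>
  have F2: "F (1, t) = - cnj (F (0, t))" for t
    by (simp add: F_def gd complex_eq_iff)
  have cont: "continuous_on {0..1} (\<lambda>s. G (s, c))" "continuous_on {0..1} (\<lambda>s. G (c, s))"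
    if "c \<in> {0..1}" for c
    by (rule continuous_on_compose2[OF G(1)]; use that in \<open>auto simp: Q_def intro!: continuous_intros\<close>)+
  \<comment> \<open>The imaginary part of \<open>w\<close> is the angle by which the projection along \<open>g 0\<close> turns.\<close>
  define w where "w = G (0, 1) - G (0, 0)"
  have "G (0, 1) - G (0, 0) = G (1, 1) - G (1, 0)"
  proof (rule logarithm_of_constant_constant[of "\<lambda>s. G (s, 1) - G (s, 0)" "-1"])
    show "continuous_on {0..1} (\<lambda>s. G (s, 1) - G (s, 0))"
      by (intro continuous_intros cont) auto
    fix s :: real assume "s \<in> {0..1}"
    then have "(s, 0) \<in> Q" "(s, 1) \<in> Q" by (auto simp: Q_def)
    then show "exp (G (s, 1) - G (s, 0)) = -1"
      using F0[of "(s, 0)"] by (simp add: exp_diff G(2)[symmetric] F1)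
  qed
  moreover have "G (1, 0) - cnj (G (0, 0)) = G (1, 1) - cnj (G (0, 1))"
  proof (rule logarithm_of_constant_constant[of "\<lambda>t. G (1, t) - cnj (G (0, t))" "-1"])
    show "continuous_on {0..1} (\<lambda>t. G (1, t) - cnj (G (0, t)))"
      by (intro continuous_intros cont) auto
    fix t :: real assume "t \<in> {0..1}"
    then have "(0, t) \<in> Q" "(1, t) \<in> Q" by (auto simp: Q_def)
    then show "exp (G (1, t) - cnj (G (0, t))) = -1"
      using F0[of "(0, t)"]
      by (simp add: exp_diff G(2)[symmetric] F2 flip: exp_cnj)
  qed
  ultimately have "G (0, 1) - G (0, 0) = cnj (G (0, 1)) - cnj (G (0, 0))"
    by algebra
  then have "w = cnj w" by (simp add: w_def)
  then have "w = of_real (Re w)" by (simp add: complex_eq_iff)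
  moreover have "exp w = -1"
  proof -
    have "(0, 0) \<in> Q" "(0, 1) \<in> Q" by (auto simp: Q_def)
    then show ?thesis
      using F0[of "(0, 0)"] by (simp add: w_def exp_diff G(2)[symmetric] F1)
  qed
  ultimately have "of_real (exp (Re w)) = (of_real (-1) :: complex)"
    by (metis exp_of_real of_real_1 of_real_minus)
  then have "exp (Re w) = -1" using of_real_eq_iff by blast
  then show False by (smt (verit) exp_gt_zero)
qed

section \<open>Edge cones in sets of diameter one\<close>

lemma inner_ge_of_unit_dist:
  fixes x y z :: "'a::real_inner"
  assumes "dist x y = 1" "dist y z \<le> 1"
  shows "(norm (z - x))\<^sup>2 / 2 \<le> (z - x) \<bullet> (y - x)"
proof -
  have "(norm (y - z))\<^sup>2 \<le> 1\<^sup>2"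
    using assms by (intro power_mono) (auto simp: dist_norm)
  moreover have "(norm (y - x))\<^sup>2 = 1"
    using assms by (simp add: dist_norm norm_minus_commute)
  moreover have "(norm (y - z))\<^sup>2 = (norm (y - x))\<^sup>2 + (norm (z - x))\<^sup>2 - 2 * ((z - x) \<bullet> (y - x))"
    by (simp add: power2_norm_eq_inner inner_diff_left inner_diff_right inner_commute)
  ultimately show ?thesis by simp
qed

text \<open>If \<open>y1\<close> and \<open>y2\<close> are neighbours of \<open>x\<close> in a diameter graph, this makes \<open>x\<close> the unique lowest
  point of the set with respect to every direction in the cone of these two edges.\<close>
lemma inner_cone_ge:
  fixes x y1 y2 z :: "'a::real_inner"
  assumes "dist x y1 = 1" "dist x y2 = 1" "dist y1 z \<le> 1" "dist y2 z \<le> 1" "0 \<le> a" "0 \<le> b"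
  shows "(a + b) * (norm (z - x))\<^sup>2 / 2 \<le> (z - x) \<bullet> (a *\<^sub>R (y1 - x) + b *\<^sub>R (y2 - x))"
  using mult_left_mono[OF inner_ge_of_unit_dist[OF assms(1,3)] \<open>0 \<le> a\<close>]
    mult_left_mono[OF inner_ge_of_unit_dist[OF assms(2,4)] \<open>0 \<le> b\<close>]
  by (simp add: inner_add_right add_divide_distrib distrib_right)

lemma cone_nonzero:
  fixes x y1 y2 :: "'a::real_inner"
  assumes "dist x y1 = 1" "dist x y2 = 1" "dist y1 y2 \<le> 1" "0 \<le> a" "0 \<le> b" "0 < a + b"
  shows "a *\<^sub>R (y1 - x) + b *\<^sub>R (y2 - x) \<noteq> 0"
  using inner_cone_ge[of x y1 y2 y1 a b] assms
  by (auto simp: dist_commute dist_norm norm_minus_commute)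

text \<open>A common direction would have two different lowest points, \<open>x\<close> and \<open>x'\<close>.\<close>
lemma cones_disjoint:
  fixes x x' y1 y2 z1 z2 :: "'a::real_inner"
  assumes "dist x y1 = 1" "dist x y2 = 1" "dist x' z1 = 1" "dist x' z2 = 1"
    and "dist y1 x' \<le> 1" "dist y2 x' \<le> 1" "dist z1 x \<le> 1" "dist z2 x \<le> 1"
    and "0 \<le> a1" "0 \<le> a2" "0 < a1 + a2" "0 \<le> b1" "0 \<le> b2"
    and eq: "a1 *\<^sub>R (y1 - x) + a2 *\<^sub>R (y2 - x) = b1 *\<^sub>R (z1 - x') + b2 *\<^sub>R (z2 - x')"
  shows "x = x'"
proof (rule ccontr)
  assume "x \<noteq> x'"
  define u where "u = a1 *\<^sub>R (y1 - x) + a2 *\<^sub>R (y2 - x)"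
  have "(a1 + a2) * (norm (x' - x))\<^sup>2 / 2 \<le> (x' - x) \<bullet> u"
    unfolding u_def using assms by (intro inner_cone_ge) auto
  moreover have "(b1 + b2) * (norm (x - x'))\<^sup>2 / 2 \<le> (x - x') \<bullet> u"
    unfolding u_def eq using assms by (intro inner_cone_ge) auto
  moreover have "(x - x') \<bullet> u = - ((x' - x) \<bullet> u)" by (simp add: inner_diff_left)
  moreover have "0 \<le> (b1 + b2) * (norm (x - x'))\<^sup>2" using assms by simp
  moreover have "0 < (a1 + a2) * (norm (x' - x))\<^sup>2" using assms \<open>x \<noteq> x'\<close> by simp
  ultimately show False by linarith
qed

lemma unit_vectors_eq_if_inner_ge_1:
  fixes v d :: "'a::real_inner"
  assumes "norm v = 1" "norm d \<le> 1" "1 \<le> v \<bullet> d"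
  shows "v = d"
proof -
  have "(norm d)\<^sup>2 \<le> 1" using assms by (simp add: power_le_one)
  then have "(norm (v - d))\<^sup>2 \<le> 0"
    using assms by (simp add: power2_norm_eq_inner inner_diff_left inner_diff_right inner_commute
        norm_eq_1)
  then show ?thesis by simp
qed

text \<open>The equality case of \<open>opposite_cones\<close>: the inner product of a combination of unit vectors with
  \<open>d\<close> attains the sum of the coefficients only if a unit vector of positive weight equals \<open>d\<close>.\<close>
lemma cone_extreme:
  fixes v1 v2 d :: "'a::real_inner"
  assumes "norm v1 = 1" "norm v2 = 1" "norm d \<le> 1" "0 \<le> a" "0 \<le> b" "0 < a + b"
    and ge: "a + b \<le> (a *\<^sub>R v1 + b *\<^sub>R v2) \<bullet> d"
  shows "d = v1 \<or> d = v2"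
proof (rule ccontr)
  assume "\<not> ?thesis"
  then have lt: "v1 \<bullet> d < 1" "v2 \<bullet> d < 1"
    using assms unit_vectors_eq_if_inner_ge_1 by (metis not_less)+
  have "a * (v1 \<bullet> d) + b * (v2 \<bullet> d) < a + b"
  proof (cases "a = 0")
    case True
    then show ?thesis using lt assms by auto
  next
    case False
    then have "a * (v1 \<bullet> d) < a" "b * (v2 \<bullet> d) \<le> b"
      using lt assms mult_left_mono[of "v2 \<bullet> d" 1 b] by auto
    then show ?thesis by linarith
  qed
  then show False using ge by (simp add: inner_add_left)
qed

text \<open>Here \<open>u\<close> has \<open>x\<close> as lowest and \<open>x'\<close> as highest point. Averaging the inequalities
  \<open>dist y\<^sub>i z\<^sub>j \<le> 1\<close> with the weights \<open>a\<^sub>i b\<^sub>j\<close> bounds the height difference \<open>u \<bullet> (x' - x)\<close> from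
  below. Compared with the Cauchy-Schwarz bound from above, this forces equality throughout: \<open>x\<close>
  and \<open>x'\<close> are at distance 1, and \<open>u\<close> points along this edge and is an extreme ray of one of the
  two cones.\<close>
lemma opposite_cones:
  fixes x x' y1 y2 z1 z2 :: "'a::real_inner"
  assumes unit: "dist x y1 = 1" "dist x y2 = 1" "dist x' z1 = 1" "dist x' z2 = 1"
    and le: "dist x x' \<le> 1"
      "dist y1 z1 \<le> 1" "dist y1 z2 \<le> 1" "dist y2 z1 \<le> 1" "dist y2 z2 \<le> 1"
    and nonneg: "0 \<le> a1" "0 \<le> a2" "0 \<le> b1" "0 \<le> b2"
    and u: "u = a1 *\<^sub>R (y1 - x) + a2 *\<^sub>R (y2 - x)" "u = - (b1 *\<^sub>R (z1 - x') + b2 *\<^sub>R (z2 - x'))"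
      "u \<noteq> 0"
  shows "x' \<in> {y1, y2} \<or> x \<in> {z1, z2}"
proof -
  define D where "D = x' - x"
  define A where "A = a1 + a2"
  define B where "B = b1 + b2"
  define t where "t = norm D"
  define r where "r = norm u"
  have t: "0 \<le> t" "t \<le> 1" using le by (auto simp: t_def D_def dist_norm norm_minus_commute)
  have norms: "norm (y1 - x) = 1" "norm (y2 - x) = 1" "norm (z1 - x') = 1" "norm (z2 - x') = 1"
    using unit by (auto simp: dist_norm norm_minus_commute)
  have r: "0 < r" using u by (simp add: r_def)
  have "r \<le> A"
    unfolding r_def A_def u(1)
    by (rule order_trans[OF norm_triangle_ineq]) (use norms nonneg in simp)
  have "r \<le> B"
    unfolding r_def B_def u(2) norm_minus_cancel
    by (rule order_trans[OF norm_triangle_ineq]) (use norms nonneg in simp)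
  have pos: "0 < A" "0 < B" using r \<open>r \<le> A\<close> \<open>r \<le> B\<close> by linarith+
  have pair: "1 + t\<^sup>2 - 2 * ((y - x) \<bullet> (z - x')) - 2 * ((y - x) \<bullet> D) + 2 * ((z - x') \<bullet> D) \<le> 0"
    if "norm (y - x) = 1" "norm (z - x') = 1" "dist y z \<le> 1" for y z
  proof -
    have "(norm (y - z))\<^sup>2 \<le> 1\<^sup>2"
      using that by (intro power_mono) (auto simp: dist_norm)
    moreover have "y - z = (y - x) - (z - x') - D" by (simp add: D_def)
    moreover have "(norm ((y - x) - (z - x') - D))\<^sup>2 =
        (norm (y - x))\<^sup>2 + (norm (z - x'))\<^sup>2 + t\<^sup>2 - 2 * ((y - x) \<bullet> (z - x'))
        - 2 * ((y - x) \<bullet> D) + 2 * ((z - x') \<bullet> D)"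
      unfolding power2_norm_eq_inner t_def
      by (simp only: inner_diff_left[of "(y - x) - (z - x')"] inner_diff_left[of "y - x" "z - x'"]
          inner_diff_right[of _ "(y - x) - (z - x')"] inner_diff_right[of _ "y - x" "z - x'"])
         (simp add: inner_commute)
    ultimately show ?thesis using that by simp
  qed
  \<comment> \<open>The inner product \<open>u \<bullet> D\<close> occurs once for each of the two expansions of \<open>u\<close>.\<close>
  have "A * B * (1 + t\<^sup>2) + 2 * (u \<bullet> u) - 2 * B * (u \<bullet> D) - 2 * A * (u \<bullet> D)
     = a1 * b1 * (1 + t\<^sup>2 - 2 * ((y1 - x) \<bullet> (z1 - x')) - 2 * ((y1 - x) \<bullet> D) + 2 * ((z1 - x') \<bullet> D))
     + a1 * b2 * (1 + t\<^sup>2 - 2 * ((y1 - x) \<bullet> (z2 - x')) - 2 * ((y1 - x) \<bullet> D) + 2 * ((z2 - x') \<bullet> D))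
     + a2 * b1 * (1 + t\<^sup>2 - 2 * ((y2 - x) \<bullet> (z1 - x')) - 2 * ((y2 - x) \<bullet> D) + 2 * ((z1 - x') \<bullet> D))
     + a2 * b2 * (1 + t\<^sup>2 - 2 * ((y2 - x) \<bullet> (z2 - x')) - 2 * ((y2 - x) \<bullet> D) + 2 * ((z2 - x') \<bullet> D))"
  proof -
    have uu: "u \<bullet> u = - (a1 * b1 * ((y1 - x) \<bullet> (z1 - x')) + a1 * b2 * ((y1 - x) \<bullet> (z2 - x'))
       + a2 * b1 * ((y2 - x) \<bullet> (z1 - x')) + a2 * b2 * ((y2 - x) \<bullet> (z2 - x')))"
      by (subst (1) u(1), subst u(2))
         (simp only: inner_add_left inner_add_right inner_minus_right inner_scaleR_left
          inner_scaleR_right, simp add: algebra_simps del: inner_diff_left inner_diff_right)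
    have uD: "u \<bullet> D = a1 * ((y1 - x) \<bullet> D) + a2 * ((y2 - x) \<bullet> D)"
      unfolding u(1) by (simp only: inner_add_left inner_scaleR_left)
    have uD': "u \<bullet> D = - (b1 * ((z1 - x') \<bullet> D) + b2 * ((z2 - x') \<bullet> D))"
      unfolding u(2) by (simp only: inner_add_left inner_scaleR_left inner_minus_left)
    have "A * B * (1 + t\<^sup>2) + 2 * (u \<bullet> u) - 2 * B * (u \<bullet> D) - 2 * A * (u \<bullet> D)
     = A * B * (1 + t\<^sup>2) + 2 * (u \<bullet> u) - 2 * B * (a1 * ((y1 - x) \<bullet> D) + a2 * ((y2 - x) \<bullet> D))
      - 2 * A * (- (b1 * ((z1 - x') \<bullet> D) + b2 * ((z2 - x') \<bullet> D)))"
      using uD uD' by simp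
    then show ?thesis unfolding uu A_def B_def by (simp add: algebra_simps)
  qed
  also have "\<dots> \<le> 0"
    by (intro add_nonpos_nonpos mult_nonneg_nonpos mult_nonneg_nonneg nonneg pair norms le)
  finally have main: "A * B * (1 + t\<^sup>2) + 2 * r\<^sup>2 \<le> 2 * (A + B) * (u \<bullet> D)"
    by (simp add: r_def power2_norm_eq_inner algebra_simps)
  have uD: "u \<bullet> D \<le> r * t" by (simp add: r_def t_def norm_cauchy_schwarz)
  \<comment> \<open>A total weight exceeds the length of \<open>u\<close> unless \<open>u\<close> is parallel to a single unit vector.\<close>
  have gap: "0 \<le> (A - r) * (B - r)" using \<open>r \<le> A\<close> \<open>r \<le> B\<close> by simp
  have "2 * (A + B) * (u \<bullet> D) \<le> 2 * (A + B) * (r * t)"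
    using uD pos by (intro mult_left_mono) auto
  moreover have "A * B * (2 * t) \<le> A * B * (1 + t\<^sup>2)"
    using pos sum_squares_bound[of t 1] by (intro mult_left_mono) auto
  ultimately have "r\<^sup>2 \<le> t * (A * r + B * r - A * B)"
    using main by (simp add: algebra_simps)
  also have "\<dots> = t * (r\<^sup>2 - (A - r) * (B - r))" by (simp add: algebra_simps power2_eq_square)
  finally have key: "r\<^sup>2 * (1 - t) + t * ((A - r) * (B - r)) \<le> 0" by (simp add: algebra_simps)
  have "0 \<le> r\<^sup>2 * (1 - t)" "0 \<le> t * ((A - r) * (B - r))" using t gap by auto
  with key have "r\<^sup>2 * (1 - t) = 0" "t * ((A - r) * (B - r)) = 0" by linarith+
  then have "t = 1" "A = r \<or> B = r" using r by auto
  have "A * B + r\<^sup>2 \<le> (A + B) * (u \<bullet> D)"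
    using main \<open>t = 1\<close> by (simp add: algebra_simps)
  moreover have "A * B + r\<^sup>2 = (A + B) * r" using \<open>A = r \<or> B = r\<close>
    by (auto simp: algebra_simps power2_eq_square)
  ultimately have ruD: "r \<le> u \<bullet> D" using pos by simp
  from \<open>A = r \<or> B = r\<close> show ?thesis
  proof
    assume "A = r"
    then have "D = y1 - x \<or> D = y2 - x"
      using ruD nonneg norms t pos unfolding A_def u(1) t_def by (intro cone_extreme[of _ _ _ a1 a2]) auto
    then show ?thesis by (auto simp: D_def)
  next
    assume "B = r"
    then have "- D = z1 - x' \<or> - D = z2 - x'"
      using ruD nonneg norms t pos unfolding B_def u(2) t_def
      by (intro cone_extreme[of _ _ _ b1 b2]) (auto simp del: minus_add_distrib)
    then show ?thesis by (auto simp: D_def)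
  qed
qed

section \<open>Graphs without odd closed walks\<close>

definition independent_set :: "('a \<Rightarrow> 'a \<Rightarrow> bool) \<Rightarrow> 'a set \<Rightarrow> bool" where
  "independent_set E I \<longleftrightarrow> (\<forall>x\<in>I. \<forall>y\<in>I. \<not> E x y)"

text \<open>Such a graph is bipartite. Fix a representative in each component and split the vertices by
  the parity of a walk from the representative. An edge inside a class would close up to an odd
  walk, so both classes are independent.\<close>
lemma large_independent_set_if_no_odd_closed_walk:
  assumes "finite S" and sym: "\<And>x y. E x y \<Longrightarrow> E y x"
    and odd: "\<And>x n. odd n \<Longrightarrow> (x, x) \<notin> {(x, y). x \<in> S \<and> y \<in> S \<and> E x y} ^^ n"
  obtains I where "I \<subseteq> S" "independent_set E I" "card S \<le> 2 * card I"
proof -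
  define R where "R = {(x, y). x \<in> S \<and> y \<in> S \<and> E x y}"
  have "R\<inverse> = R" using sym by (auto simp: R_def)
  then have rev: "(y, x) \<in> R ^^ n" if "(x, y) \<in> R ^^ n" for x y n
    using that
  proof (induction n arbitrary: y)
    case (Suc n)
    then obtain z where "(x, z) \<in> R ^^ n" "(z, y) \<in> R" by auto
    then have "(y, z) \<in> R" "(z, x) \<in> R ^^ n" using Suc.IH \<open>R\<inverse> = R\<close> by blast+
    then show ?case by (rule relpow_Suc_I2)
  qed simp
  have odd: "(x, x) \<notin> R ^^ n" if "odd n" for x n
    using odd that by (simp add: R_def)
  define rep where "rep = (\<lambda>x. SOME y. (y, x) \<in> R\<^sup>*)"
  have rep: "(rep x, x) \<in> R\<^sup>*" for x
    unfolding rep_def by (rule someI[of _ x]) simp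
  have rep_eq: "rep x = rep y" if "(x, y) \<in> R" for x y
  proof -
    have "(y, x) \<in> R" using that \<open>R\<inverse> = R\<close> by blast
    with that have "(z, x) \<in> R\<^sup>* \<longleftrightarrow> (z, y) \<in> R\<^sup>*" for z
      by (meson rtrancl.rtrancl_into_rtrancl)
    then show ?thesis by (simp add: rep_def)
  qed
  have no_edge: False
    if "(x, y) \<in> R" "(rep x, x) \<in> R ^^ m" "(rep y, y) \<in> R ^^ n" "even m \<longleftrightarrow> even n" for x y m n
  proof -
    have "(y, rep x) \<in> R ^^ n" using rev that(3) rep_eq[OF that(1)] by simp
    then have "(x, x) \<in> R ^^ (Suc n + m)"
      using relpow_trans[OF relpow_Suc_I2[OF that(1)] that(2)] by blast
    then show False using odd that(4) by (metis add_Suc even_Suc odd_add)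
  qed
  define A where "A = {x \<in> S. \<exists>n. even n \<and> (rep x, x) \<in> R ^^ n}"
  define B where "B = S - A"
  have "independent_set E A"
    unfolding independent_set_def
  proof (intro ballI notI)
    fix x y assume "x \<in> A" "y \<in> A" "E x y"
    moreover from this have "(x, y) \<in> R" by (auto simp: A_def R_def)
    ultimately show False using no_edge unfolding A_def by blast
  qed
  moreover have "independent_set E B"
    unfolding independent_set_def
  proof (intro ballI notI)
    have oddB: "\<exists>n. odd n \<and> (rep x, x) \<in> R ^^ n" if "x \<in> B" for x
      using that rep[of x] unfolding A_def B_def rtrancl_power by blast
    fix x y assume "x \<in> B" "y \<in> B" "E x y"
    moreover from this have "(x, y) \<in> R" by (auto simp: A_def B_def R_def)
    ultimately show False using no_edge oddB by meson
  qed
  moreover have "A \<subseteq> S" "B \<subseteq> S" by (auto simp: A_def B_def)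
  moreover have "card S = card A + card B"
    using \<open>finite S\<close> unfolding B_def by (metis \<open>A \<subseteq> S\<close> card_Diff_subset card_mono finite_subset le_add_diff_inverse)
  ultimately show ?thesis using that
    by (cases "card A \<le> card B") fastforce+
qed

section \<open>Graphs without triangles and closed walks of length five\<close>

text \<open>Vertices in \<open>no_pentagon\<close> may repeat, so closed walks of length five are excluded, not only
  5-cycles.\<close>
locale odd_girth_over_five =
  fixes E :: "'a \<Rightarrow> 'a \<Rightarrow> bool"
  assumes sym: "E x y \<Longrightarrow> E y x"
    and no_triangle: "E x y \<Longrightarrow> E y z \<Longrightarrow> E z x \<Longrightarrow> False"
    and no_pentagon: "E u v \<Longrightarrow> E v w \<Longrightarrow> E w x \<Longrightarrow> E x y \<Longrightarrow> E y u \<Longrightarrow> False"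
begin

definition has_indep :: "nat \<Rightarrow> 'a set \<Rightarrow> bool" where
  "has_indep k S \<longleftrightarrow> (\<exists>I\<subseteq>S. independent_set E I \<and> k \<le> card I)"

text \<open>Quantifying over all sets of at least \<open>m\<close> vertices, and so over all induced subgraphs, lets a
  bound be applied to what is left after deleting a part of the graph.\<close>
definition indep_bound :: "nat \<Rightarrow> nat \<Rightarrow> bool" where
  "indep_bound m k \<longleftrightarrow> (\<forall>S. finite S \<longrightarrow> m \<le> card S \<longrightarrow> has_indep k S)"

definition nbrs :: "'a set \<Rightarrow> 'a \<Rightarrow> 'a set" where
  "nbrs S v = {w \<in> S. E v w}"

definition second_nbrs :: "'a set \<Rightarrow> 'a \<Rightarrow> 'a set" where
  "second_nbrs S v = (\<Union>u\<in>nbrs S v. nbrs S u - {v})"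

abbreviation "deg S v \<equiv> card (nbrs S v)"
abbreviation "deg2 S v \<equiv> card (second_nbrs S v)"

lemma has_indep_mono: "has_indep k S \<Longrightarrow> l \<le> k \<Longrightarrow> has_indep l S"
  unfolding has_indep_def by (meson le_trans)

lemma indep_boundD: "indep_bound m k \<Longrightarrow> finite S \<Longrightarrow> m \<le> card S \<Longrightarrow> has_indep k S"
  unfolding indep_bound_def by blast

lemma irrefl: "\<not> E x x"
  using no_triangle by blast

lemma has_indep_nbrs: "has_indep (deg S v) S"
  unfolding has_indep_def independent_set_def
  by (intro exI[of _ "nbrs S v"]) (auto simp: nbrs_def dest: no_triangle intro: sym)

text \<open>An edge between two second neighbours of \<open>v\<close> would give a closed walk of length five through
  \<open>v\<close>.\<close>
lemma has_indep_second_nbrs: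
  assumes "finite S" "v \<in> S"
  shows "has_indep (Suc (deg2 S v)) S"
proof -
  have "finite (second_nbrs S v)" "v \<notin> second_nbrs S v"
    using assms by (auto simp: second_nbrs_def nbrs_def)
  then have "card (insert v (second_nbrs S v)) = Suc (deg2 S v)" by simp
  moreover have "independent_set E (insert v (second_nbrs S v))"
    unfolding independent_set_def second_nbrs_def nbrs_def
    by (auto simp: irrefl) (meson no_triangle no_pentagon sym)+
  moreover have "insert v (second_nbrs S v) \<subseteq> S"
    using assms by (auto simp: second_nbrs_def nbrs_def)
  ultimately show ?thesis unfolding has_indep_def by (metis order_refl)
qed

lemma has_indep_extend:
  assumes "finite S" "independent_set E I" "I \<subseteq> S" "indep_bound m k" "J \<subseteq> S" "I \<inter> J = {}"
    and "m \<le> card J" and "\<And>x y. x \<in> I \<Longrightarrow> y \<in> J \<Longrightarrow> \<not> E x y"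
  shows "has_indep (card I + k) S"
proof -
  have fin: "finite I" "finite J" using assms finite_subset by blast+
  then obtain K where K: "K \<subseteq> J" "independent_set E K" "k \<le> card K"
    using indep_boundD[OF assms(4) fin(2) assms(7)] unfolding has_indep_def by blast
  have "card (I \<union> K) = card I + card K"
    using K fin assms(6) by (intro card_Un_disjoint) (auto intro: finite_subset)
  moreover have "independent_set E (I \<union> K)"
    using K assms(2,8) sym unfolding independent_set_def by blast
  ultimately show ?thesis using K assms(3,5) unfolding has_indep_def
    by (intro exI[of _ "I \<union> K"]) auto
qed

lemma has_indep_delete_nbrs:
  assumes "finite S" "v \<in> S" "indep_bound m k" "m + 1 + deg S v \<le> card S"
  shows "has_indep (1 + k) S"
proof -
  have fin: "finite (nbrs S v)" using assms(1) by (simp add: nbrs_def)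
  define J where "J = S - insert v (nbrs S v)"
  have "card (insert v (nbrs S v)) \<le> 1 + deg S v"
    using fin by (simp add: card_insert_if)
  moreover have "card S - card (insert v (nbrs S v)) \<le> card J"
    unfolding J_def using fin by (intro diff_card_le_card_Diff) auto
  ultimately have "m \<le> card J" using assms(4) by linarith
  then have "has_indep (card {v} + k) S"
    using assms by (intro has_indep_extend[of S "{v}" m k J]) (auto simp: J_def nbrs_def independent_set_def irrefl)
  then show ?thesis by simp
qed

lemma has_indep_delete_ball:
  assumes "finite S" "v \<in> S" "indep_bound m k" "m + 1 + deg S v + deg2 S v \<le> card S"
  shows "has_indep (deg S v + k) S"
proof -
  have fin: "finite (nbrs S v)" "finite (second_nbrs S v)"
    using assms(1) by (auto simp: nbrs_def second_nbrs_def)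
  define B where "B = insert v (nbrs S v \<union> second_nbrs S v)"
  define J where "J = S - B"
  have "card B \<le> Suc (card (nbrs S v \<union> second_nbrs S v))"
    unfolding B_def using fin by (simp add: card_insert_if)
  also have "\<dots> \<le> Suc (deg S v + deg2 S v)" by (simp add: card_Un_le)
  finally have "card B \<le> 1 + deg S v + deg2 S v" by simp
  moreover have "card S - card B \<le> card J"
    unfolding J_def B_def using fin by (intro diff_card_le_card_Diff) auto
  ultimately have "m \<le> card J" using assms(4) by linarith
  moreover have "independent_set E (nbrs S v)"
    unfolding independent_set_def by (auto simp: nbrs_def dest: no_triangle intro: sym)
  ultimately show ?thesis
    using assms by (intro has_indep_extend[of S _ m k J]) (auto simp: J_def B_def nbrs_def second_nbrs_def)
qed

text \<open>A vertex \<open>v\<close> offers four ways to build an independent set: its neighbours; \<open>v\<close> together with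
  its second neighbours; its neighbours together with an independent set outside the ball of radius
  two; and \<open>v\<close> together with an independent set outside the ball of radius one.\<close>
lemma has_indep_step:
  assumes "finite S" "v \<in> S"
    and "deg S v < k \<Longrightarrow> deg2 S v + 1 < k \<Longrightarrow>
      (\<exists>m j. indep_bound m j \<and> (m + 1 + deg S v + deg2 S v \<le> card S \<and> k \<le> deg S v + j
          \<or> m + 1 + deg S v \<le> card S \<and> k \<le> 1 + j))"
  shows "has_indep k S"
proof (cases "deg S v < k \<and> deg2 S v + 1 < k")
  case True
  with assms(3) obtain m j where "indep_bound m j"
    and "m + 1 + deg S v + deg2 S v \<le> card S \<and> k \<le> deg S v + j
      \<or> m + 1 + deg S v \<le> card S \<and> k \<le> 1 + j" by blast
  then show ?thesis
    using has_indep_delete_ball[OF assms(1,2)] has_indep_delete_nbrs[OF assms(1,2)] has_indep_mono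
    by blast
next
  case False
  then have "k \<le> deg S v \<or> k \<le> Suc (deg2 S v)" by linarith
  then show ?thesis
    using has_indep_nbrs has_indep_second_nbrs[OF assms(1,2)] has_indep_mono by blast
qed

text \<open>Each neighbour of \<open>v\<close> has at most one neighbour other than \<open>v\<close>.\<close>
lemma deg2_le_if_degs_le_2:
  assumes "finite S" "v \<in> S" "\<And>u. u \<in> S \<Longrightarrow> deg S u \<le> 2"
  shows "deg2 S v \<le> deg S v"
proof -
  have fin: "finite (nbrs S v)" using assms(1) by (simp add: nbrs_def)
  have "deg2 S v \<le> (\<Sum>u\<in>nbrs S v. card (nbrs S u - {v}))"
    unfolding second_nbrs_def using fin by (rule card_UN_le)
  also have "\<dots> \<le> (\<Sum>u\<in>nbrs S v. 1)"
  proof (rule sum_mono)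
    fix u assume u: "u \<in> nbrs S v"
    then have "v \<in> nbrs S u" "u \<in> S" using assms(2) sym by (auto simp: nbrs_def)
    moreover have "finite (nbrs S u)" using assms(1) by (simp add: nbrs_def)
    ultimately show "card (nbrs S u - {v}) \<le> 1" using assms(3)[of u] by simp
  qed
  finally show ?thesis by simp
qed

lemma indep_bound_1: "indep_bound 1 1"
  unfolding indep_bound_def has_indep_def
proof (intro allI impI)
  fix S :: "'a set" assume "finite S" "1 \<le> card S"
  then obtain v where "v \<in> S" by fastforce
  then show "\<exists>I\<subseteq>S. independent_set E I \<and> 1 \<le> card I"
    by (intro exI[of _ "{v}"]) (simp add: independent_set_def irrefl)
qed

text \<open>Choosing a vertex of maximum degree reduces each bound to arithmetic in the number \<open>a\<close> of its
  neighbours and the number \<open>b\<close> of its second neighbours. If \<open>a \<le> 2\<close>, then by maximality all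
  degrees are at most two, whence \<open>b \<le> a\<close>.\<close>
lemma indep_boundI:
  assumes "0 < n"
    and step: "\<And>a b. a < k \<Longrightarrow> b + 1 < k \<Longrightarrow> a \<le> 2 \<longrightarrow> b \<le> a \<Longrightarrow>
      \<exists>m j. indep_bound m j \<and>
        (m + 1 + a + b \<le> n \<and> k \<le> a + j \<or> m + 1 + a \<le> n \<and> k \<le> 1 + j)"
  shows "indep_bound n k"
  unfolding indep_bound_def
proof (intro allI impI)
  fix S :: "'a set" assume S: "finite S" "n \<le> card S"
  with assms(1) have "S \<noteq> {}" by auto
  have "Max (deg S ` S) \<in> deg S ` S"
    using S(1) \<open>S \<noteq> {}\<close> by (intro Max_in) auto
  then obtain v where v: "v \<in> S" "deg S v = Max (deg S ` S)" by auto
  then have max: "deg S u \<le> deg S v" if "u \<in> S" for u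
    using that S(1) by simp
  have le: "deg S v \<le> 2 \<longrightarrow> deg2 S v \<le> deg S v"
    using deg2_le_if_degs_le_2[OF S(1) v(1)] max by (meson le_trans)
  show "has_indep k S"
  proof (rule has_indep_step[OF S(1) v(1)])
    assume "deg S v < k" "deg2 S v + 1 < k"
    from step[OF this le] obtain m j where "indep_bound m j"
      "m + 1 + deg S v + deg2 S v \<le> n \<and> k \<le> deg S v + j \<or> m + 1 + deg S v \<le> n \<and> k \<le> 1 + j"
      by blast
    with S(2) show "\<exists>m j. indep_bound m j \<and> (m + 1 + deg S v + deg2 S v \<le> card S \<and> k \<le> deg S v + j
        \<or> m + 1 + deg S v \<le> card S \<and> k \<le> 1 + j)"
      by (intro exI[of _ m] exI[of _ j]) auto
  qed
qed

text \<open>For each possible \<open>a\<close> it remains to name the earlier bound that handles the rest of the graph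
  after deleting a ball around the vertex. The sizes are chosen so that the chain reaches eight
  independent vertices among 20.\<close>
lemma indep_bound_3: "indep_bound 3 2"
proof (rule indep_boundI)
  fix a b :: nat
  assume ab: "a < 2" "b + 1 < 2" "a \<le> 2 \<longrightarrow> b \<le> a"
  then consider "a \<le> 1" by linarith
  then show "\<exists>m j. indep_bound m j \<and> (m + 1 + a + b \<le> 3 \<and> 2 \<le> a + j \<or> m + 1 + a \<le> 3 \<and> 2 \<le> 1 + j)"
  proof cases
    case 1
    with ab indep_bound_1 show ?thesis by (intro exI[of _ 1] exI[of _ 1]) auto
  qed
qed simp

lemma indep_bound_5: "indep_bound 5 3"
proof (rule indep_boundI)
  fix a b :: nat
  assume ab: "a < 3" "b + 1 < 3" "a \<le> 2 \<longrightarrow> b \<le> a"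
  then consider "a \<le> 1" | "a = 2" by linarith
  then show "\<exists>m j. indep_bound m j \<and> (m + 1 + a + b \<le> 5 \<and> 3 \<le> a + j \<or> m + 1 + a \<le> 5 \<and> 3 \<le> 1 + j)"
  proof cases
    case 1
    with ab indep_bound_3 show ?thesis by (intro exI[of _ 3] exI[of _ 2]) auto
  next
    case 2
    with ab indep_bound_1 show ?thesis by (intro exI[of _ 1] exI[of _ 1]) auto
  qed
qed simp

lemma indep_bound_8: "indep_bound 8 4"
proof (rule indep_boundI)
  fix a b :: nat
  assume ab: "a < 4" "b + 1 < 4" "a \<le> 2 \<longrightarrow> b \<le> a"
  then consider "a \<le> 2" | "a = 3" by linarith
  then show "\<exists>m j. indep_bound m j \<and> (m + 1 + a + b \<le> 8 \<and> 4 \<le> a + j \<or> m + 1 + a \<le> 8 \<and> 4 \<le> 1 + j)"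
  proof cases
    case 1
    with ab indep_bound_5 show ?thesis by (intro exI[of _ 5] exI[of _ 3]) auto
  next
    case 2
    with ab indep_bound_1 show ?thesis by (intro exI[of _ 1] exI[of _ 1]) auto
  qed
qed simp

lemma indep_bound_10: "indep_bound 10 5"
proof (rule indep_boundI)
  fix a b :: nat
  assume ab: "a < 5" "b + 1 < 5" "a \<le> 2 \<longrightarrow> b \<le> a"
  then consider "a \<le> 1" | "a = 2" | "a = 3" | "a = 4" by linarith
  then show "\<exists>m j. indep_bound m j \<and> (m + 1 + a + b \<le> 10 \<and> 5 \<le> a + j \<or> m + 1 + a \<le> 10 \<and> 5 \<le> 1 + j)"
  proof cases
    case 1
    with ab indep_bound_8 show ?thesis by (intro exI[of _ 8] exI[of _ 4]) auto
  next
    case 2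
    with ab indep_bound_5 show ?thesis by (intro exI[of _ 5] exI[of _ 3]) auto
  next
    case 3
    with ab indep_bound_3 show ?thesis by (intro exI[of _ 3] exI[of _ 2]) auto
  next
    case 4
    with ab indep_bound_1 show ?thesis by (intro exI[of _ 1] exI[of _ 1]) auto
  qed
qed simp

lemma indep_bound_15: "indep_bound 15 6"
proof (rule indep_boundI)
  fix a b :: nat
  assume ab: "a < 6" "b + 1 < 6" "a \<le> 2 \<longrightarrow> b \<le> a"
  then consider "a \<le> 1" | "a = 2" | "a = 3" | "a = 4" | "a = 5" by linarith
  then show "\<exists>m j. indep_bound m j \<and> (m + 1 + a + b \<le> 15 \<and> 6 \<le> a + j \<or> m + 1 + a \<le> 15 \<and> 6 \<le> 1 + j)"
  proof cases
    case 1
    with ab indep_bound_10 show ?thesis by (intro exI[of _ 10] exI[of _ 5]) auto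
  next
    case 2
    with ab indep_bound_8 show ?thesis by (intro exI[of _ 8] exI[of _ 4]) auto
  next
    case 3
    with ab indep_bound_5 show ?thesis by (intro exI[of _ 5] exI[of _ 3]) auto
  next
    case 4
    with ab indep_bound_3 show ?thesis by (intro exI[of _ 3] exI[of _ 2]) auto
  next
    case 5
    with ab indep_bound_1 show ?thesis by (intro exI[of _ 1] exI[of _ 1]) auto
  qed
qed simp

lemma indep_bound_18: "indep_bound 18 7"
proof (rule indep_boundI)
  fix a b :: nat
  assume ab: "a < 7" "b + 1 < 7" "a \<le> 2 \<longrightarrow> b \<le> a"
  then consider "a \<le> 1" | "a = 2" | "a = 3" | "a = 4" | "a = 5" | "a = 6" by linarith
  then show "\<exists>m j. indep_bound m j \<and> (m + 1 + a + b \<le> 18 \<and> 7 \<le> a + j \<or> m + 1 + a \<le> 18 \<and> 7 \<le> 1 + j)"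
  proof cases
    case 1
    with ab indep_bound_15 show ?thesis by (intro exI[of _ 15] exI[of _ 6]) auto
  next
    case 2
    with ab indep_bound_10 show ?thesis by (intro exI[of _ 10] exI[of _ 5]) auto
  next
    case 3
    with ab indep_bound_8 show ?thesis by (intro exI[of _ 8] exI[of _ 4]) auto
  next
    case 4
    with ab indep_bound_5 show ?thesis by (intro exI[of _ 5] exI[of _ 3]) auto
  next
    case 5
    with ab indep_bound_3 show ?thesis by (intro exI[of _ 3] exI[of _ 2]) auto
  next
    case 6
    with ab indep_bound_1 show ?thesis by (intro exI[of _ 1] exI[of _ 1]) auto
  qed
qed simp

lemma indep_bound_20: "indep_bound 20 8"
proof (rule indep_boundI)
  fix a b :: nat
  assume ab: "a < 8" "b + 1 < 8" "a \<le> 2 \<longrightarrow> b \<le> a"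
  then consider "a \<le> 1" | "a = 2" | "a = 3" | "a = 4" | "a = 5" | "a = 6" | "a = 7" by linarith
  then show "\<exists>m j. indep_bound m j \<and> (m + 1 + a + b \<le> 20 \<and> 8 \<le> a + j \<or> m + 1 + a \<le> 20 \<and> 8 \<le> 1 + j)"
  proof cases
    case 1
    with ab indep_bound_18 show ?thesis by (intro exI[of _ 18] exI[of _ 7]) auto
  next
    case 2
    with ab indep_bound_15 show ?thesis by (intro exI[of _ 15] exI[of _ 6]) auto
  next
    case 3
    with ab indep_bound_10 show ?thesis by (intro exI[of _ 10] exI[of _ 5]) auto
  next
    case 4
    with ab indep_bound_8 show ?thesis by (intro exI[of _ 8] exI[of _ 4]) auto
  next
    case 5
    with ab indep_bound_5 show ?thesis by (intro exI[of _ 5] exI[of _ 3]) auto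
  next
    case 6
    with ab indep_bound_3 show ?thesis by (intro exI[of _ 3] exI[of _ 2]) auto
  next
    case 7
    with ab indep_bound_1 show ?thesis by (intro exI[of _ 1] exI[of _ 1]) auto
  qed
qed simp

end

section \<open>Odd closed walks in diameter graphs\<close>

lemma polygonal_path:
  fixes p :: "nat \<Rightarrow> 'a::real_normed_vector"
  obtains \<gamma> where "path \<gamma>" "pathstart \<gamma> = p 0" "pathfinish \<gamma> = p n"
    "path_image \<gamma> \<subseteq> insert (p 0) (\<Union>i<n. closed_segment (p i) (p (Suc i)))"
proof (induction n arbitrary: thesis)
  case 0
  show ?case
    by (rule 0[of "\<lambda>_. p 0"]) (auto simp: path_def pathstart_def pathfinish_def path_image_def)
next
  case (Suc n)
  obtain \<gamma> where \<gamma>: "path \<gamma>" "pathstart \<gamma> = p 0" "pathfinish \<gamma> = p n"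
    "path_image \<gamma> \<subseteq> insert (p 0) (\<Union>i<n. closed_segment (p i) (p (Suc i)))"
    by (rule Suc.IH)
  show ?case
    by (rule Suc.prems[of "\<gamma> +++ linepath (p n) (p (Suc n))"])
       (use \<gamma> in \<open>auto simp: path_image_join lessThan_Suc\<close>)
qed

text \<open>Planes through the origin have measure zero.\<close>
lemma vector_outside_finitely_many_planes:
  fixes p q :: "'i \<Rightarrow> real^3"
  assumes "finite I"
  obtains N where "\<And>i. i \<in> I \<Longrightarrow> N \<notin> span {p i, q i}"
proof -
  have "negligible (span {p i, q i})" for i
  proof (rule negligible_lowdim)
    have "dim (span {p i, q i}) \<le> card {p i, q i}"
      using dim_le_card[of "span {p i, q i}" "{p i, q i}"] by simp
    also have "\<dots> \<le> 2" by (simp add: card_insert_if)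
    finally show "dim (span {p i, q i}) < DIM(real^3)" by simp
  qed
  then have "negligible (\<Union>i\<in>I. span {p i, q i})"
    using assms by (intro negligible_Union) auto
  then have "(\<Union>i\<in>I. span {p i, q i}) \<noteq> UNIV" by (metis non_negligible_UNIV)
  then show ?thesis using that by blast
qed

text \<open>Nonzero multiples of the vectors in the cone of two edges at a common vertex; the factor \<open>c\<close> may be
  negative because the edge vectors of a walk are taken with alternating signs.\<close>
definition corner_vector :: "'a::real_inner set \<Rightarrow> 'a \<Rightarrow> bool" where
  "corner_vector F z \<longleftrightarrow> (\<exists>x\<in>F. \<exists>y1\<in>F. \<exists>y2\<in>F. \<exists>a b c. dist x y1 = 1 \<and> dist x y2 = 1 \<and>
     0 \<le> a \<and> 0 \<le> b \<and> 0 < a + b \<and> c \<noteq> 0 \<and> z = c *\<^sub>R (a *\<^sub>R (y1 - x) + b *\<^sub>R (y2 - x)))"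

lemma corner_vectorI:
  assumes "x \<in> F" "y1 \<in> F" "y2 \<in> F" "dist x y1 = 1" "dist x y2 = 1"
    and "0 \<le> a" "0 \<le> b" "0 < a + b" "c \<noteq> 0" "z = c *\<^sub>R (a *\<^sub>R (y1 - x) + b *\<^sub>R (y2 - x))"
  shows "corner_vector F z"
  unfolding corner_vector_def
  by (intro bexI[of _ x] bexI[of _ y1] bexI[of _ y2] exI[of _ a] exI[of _ b] exI[of _ c] conjI assms)

lemma corner_vector_nonzero:
  assumes "corner_vector F z" "\<And>x y. x \<in> F \<Longrightarrow> y \<in> F \<Longrightarrow> dist x y \<le> 1"
  shows "z \<noteq> 0"
proof -
  obtain x y1 y2 a b c where z: "y1 \<in> F" "y2 \<in> F" "dist x y1 = 1" "dist x y2 = 1"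
    "0 \<le> a" "0 \<le> b" "0 < a + b" "c \<noteq> 0" "z = c *\<^sub>R (a *\<^sub>R (y1 - x) + b *\<^sub>R (y2 - x))"
    using assms(1) unfolding corner_vector_def by blast
  then show ?thesis using cone_nonzero[OF z(3,4) assms(2)[OF z(1,2)] z(5-7)] by simp
qed

text \<open>Parallel corner vectors mean that two cones meet, or that one meets the negative of the other,
  according to the sign of the ratio. The first makes the two corners equal, the second makes one
  corner an endpoint of an edge at the other; neither is possible for disjoint vertex sets.\<close>
lemma corner_vectors_not_parallel:
  fixes z w :: "'a::real_inner"
  assumes "corner_vector F z" "corner_vector G w" "F \<inter> G = {}"
    and diam: "\<And>x y. x \<in> F \<union> G \<Longrightarrow> y \<in> F \<union> G \<Longrightarrow> dist x y \<le> 1"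
  shows "z \<noteq> k *\<^sub>R w"
proof
  assume zw: "z = k *\<^sub>R w"
  obtain x y1 y2 a1 a2 c where z: "x \<in> F" "y1 \<in> F" "y2 \<in> F" "dist x y1 = 1" "dist x y2 = 1"
    "0 \<le> a1" "0 \<le> a2" "0 < a1 + a2" "c \<noteq> 0" "z = c *\<^sub>R (a1 *\<^sub>R (y1 - x) + a2 *\<^sub>R (y2 - x))"
    using assms(1) unfolding corner_vector_def by blast
  obtain x' z1 z2 b1 b2 d where w: "x' \<in> G" "z1 \<in> G" "z2 \<in> G" "dist x' z1 = 1" "dist x' z2 = 1"
    "0 \<le> b1" "0 \<le> b2" "0 < b1 + b2" "d \<noteq> 0" "w = d *\<^sub>R (b1 *\<^sub>R (z1 - x') + b2 *\<^sub>R (z2 - x'))"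
    using assms(2) unfolding corner_vector_def by blast
  define u where "u = a1 *\<^sub>R (y1 - x) + a2 *\<^sub>R (y2 - x)"
  define l where "l = k * d / c"
  have "z \<noteq> 0" using assms(1) diam by (intro corner_vector_nonzero) auto
  then have "u \<noteq> 0" using z(10) by (auto simp: u_def)
  have "c *\<^sub>R u = (k * d) *\<^sub>R (b1 *\<^sub>R (z1 - x') + b2 *\<^sub>R (z2 - x'))"
    using z(10) w(10) zw by (simp add: u_def)
  then have "(1 / c) *\<^sub>R (c *\<^sub>R u) = (1 / c) *\<^sub>R ((k * d) *\<^sub>R (b1 *\<^sub>R (z1 - x') + b2 *\<^sub>R (z2 - x')))"
    by (rule arg_cong)
  then have u: "u = l *\<^sub>R (b1 *\<^sub>R (z1 - x') + b2 *\<^sub>R (z2 - x'))"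
    using z(9) by (simp add: l_def)
  show False
  proof (cases "0 \<le> l")
    case True
    have "x = x'"
      by (rule cones_disjoint[of x y1 y2 x' z1 z2 a1 a2 "l * b1" "l * b2"])
        (use z w diam True u in \<open>auto simp: u_def scaleR_add_right\<close>)
    then show False using z w assms(3) by blast
  next
    case False
    have "x' \<in> {y1, y2} \<or> x \<in> {z1, z2}"
    proof (rule opposite_cones[of x y1 y2 x' z1 z2 a1 a2 "- l * b1" "- l * b2" u])
      show "u = - ((- l * b1) *\<^sub>R (z1 - x') + (- l * b2) *\<^sub>R (z2 - x'))"
        using u by (simp add: scaleR_add_right)
    qed (use z w diam False \<open>u \<noteq> 0\<close> in \<open>auto simp: u_def mult_nonpos_nonneg\<close>)
    then show False using z w assms(3) by blast
  qed
qed

text \<open>The path runs through the edge vectors \<open>p i\<close> of the walk, taken with alternating signs. After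
  an odd number of steps the sign has changed, so it ends at \<open>- p 0\<close>. The alternation also makes
  consecutive vectors point both away from, or both towards, the vertex that the two edges share,
  so each side of the polygon lies in an edge cone or its negative.\<close>
lemma odd_closed_walk_antipodal_path:
  fixes f :: "nat \<Rightarrow> real^3"
  assumes "odd n" "f n = f 0" and unit: "\<And>i. i < n \<Longrightarrow> dist (f i) (f (Suc i)) = 1"
    and diam: "\<And>i j. i < n \<Longrightarrow> j < n \<Longrightarrow> dist (f i) (f j) \<le> 1"
  obtains \<gamma> N where "path \<gamma>" "pathfinish \<gamma> = - pathstart \<gamma>"
    "\<And>z. z \<in> path_image \<gamma> \<Longrightarrow> corner_vector (f ` {..<n}) z"
    "\<And>z. z \<in> path_image \<gamma> \<Longrightarrow> cross3 N z \<noteq> 0"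
proof -
  have "0 < n" using assms(1) by (rule odd_pos)
  \<comment> \<open>The last side of the polygon belongs to the corner \<open>f n = f 0\<close> and uses the edge from \<open>f 0\<close>
      to \<open>f 1\<close> again, hence the periodic continuation.\<close>
  define h where "h = (\<lambda>i. f (i mod n))"
  have hF: "h i \<in> f ` {..<n}" for i using \<open>0 < n\<close> by (simp add: h_def)
  have h_Suc: "h (Suc i) = f (Suc (i mod n))" for i
    using assms(2) by (simp add: h_def mod_Suc)
  have h_unit: "dist (h i) (h (Suc i)) = 1" for i
    unfolding h_Suc using unit[of "i mod n"] \<open>0 < n\<close> by (simp add: h_def)
  have h_period: "h (n + i) = h i" for i by (simp add: h_def)
  define p where "p = (\<lambda>i. (-1) ^ i *\<^sub>R (h (Suc i) - h i))"
  have pn: "p n = - p 0"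
    using assms(1) h_period[of 0] h_period[of 1] by (simp add: p_def)
  have seg: "corner_vector (f ` {..<n}) z" if z: "z \<in> closed_segment (p i) (p (Suc i))" for i z
  proof -
    obtain t where t: "0 \<le> t" "t \<le> 1" "z = (1 - t) *\<^sub>R p i + t *\<^sub>R p (Suc i)"
      using z by (auto simp: in_segment)
    have "z = (- ((-1) ^ i)) *\<^sub>R
        ((1 - t) *\<^sub>R (h i - h (Suc i)) + t *\<^sub>R (h (Suc (Suc i)) - h (Suc i)))"
      unfolding t(3) p_def by (simp add: algebra_simps)
    then show ?thesis
      by (rule corner_vectorI[rotated -1])
         (use t hF h_unit[of i] h_unit[of "Suc i"] in \<open>simp_all add: dist_commute\<close>)
  qed
  obtain \<gamma> where \<gamma>: "path \<gamma>" "pathstart \<gamma> = p 0" "pathfinish \<gamma> = p n"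
    "path_image \<gamma> \<subseteq> insert (p 0) (\<Union>i<n. closed_segment (p i) (p (Suc i)))"
    by (rule polygonal_path)
  have image: "\<exists>i<n. z \<in> closed_segment (p i) (p (Suc i))" if "z \<in> path_image \<gamma>" for z
    using that \<gamma>(4) \<open>0 < n\<close> by auto
  obtain N where N: "\<And>i. i \<in> {..<n} \<Longrightarrow> N \<notin> span {p i, p (Suc i)}"
    using vector_outside_finitely_many_planes[of "{..<n}" p "\<lambda>i. p (Suc i)"] by blast
  have corner: "corner_vector (f ` {..<n}) z" if "z \<in> path_image \<gamma>" for z
    using image[OF that] seg by blast
  show ?thesis
  proof (rule that[OF \<gamma>(1) _ corner])
    show "pathfinish \<gamma> = - pathstart \<gamma>" using \<gamma> pn by simp
    fix z assume z: "z \<in> path_image \<gamma>"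
    then obtain i where i: "i < n" "z \<in> closed_segment (p i) (p (Suc i))" using image by blast
    have "z \<noteq> 0"
      using corner_vector_nonzero[OF corner[OF z]] diam by auto
    obtain t where "z = (1 - t) *\<^sub>R p i + t *\<^sub>R p (Suc i)"
      using i(2) by (auto simp: in_segment)
    then have "z \<in> span {p i, p (Suc i)}"
      by (simp only: span_add span_scale span_base insertI1 insertI2)
    show "cross3 N z \<noteq> 0"
    proof
      assume "cross3 N z = 0"
      then have "collinear {0, z, N}" by (simp add: cross_eq_0 insert_commute)
      then obtain c where "N = c *\<^sub>R z"
        using \<open>z \<noteq> 0\<close> by (auto simp: collinear_lemma)
      then have "N \<in> span {p i, p (Suc i)}"
        using \<open>z \<in> span {p i, p (Suc i)}\<close> by (simp add: span_scale)
      then show False using N i by blast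
    qed
  qed
qed

lemma odd_closed_walks_meet_unit:
  fixes f g :: "nat \<Rightarrow> real^3"
  assumes "odd n" "f n = f 0" "\<And>i. i < n \<Longrightarrow> dist (f i) (f (Suc i)) = 1"
    and "odd m" "g m = g 0" "\<And>i. i < m \<Longrightarrow> dist (g i) (g (Suc i)) = 1"
    and diam: "\<And>x y. x \<in> f ` {..<n} \<union> g ` {..<m} \<Longrightarrow> y \<in> f ` {..<n} \<union> g ` {..<m} \<Longrightarrow> dist x y \<le> 1"
  shows "f ` {..<n} \<inter> g ` {..<m} \<noteq> {}"
proof
  assume disjoint: "f ` {..<n} \<inter> g ` {..<m} = {}"
  obtain \<gamma> N where \<gamma>: "path \<gamma>" "pathfinish \<gamma> = - pathstart \<gamma>"
    "\<And>z. z \<in> path_image \<gamma> \<Longrightarrow> corner_vector (f ` {..<n}) z"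
    "\<And>z. z \<in> path_image \<gamma> \<Longrightarrow> cross3 N z \<noteq> 0"
    using odd_closed_walk_antipodal_path[of n f] assms(1-3) diam by blast
  obtain \<delta> M where \<delta>: "path \<delta>" "pathfinish \<delta> = - pathstart \<delta>"
    "\<And>z. z \<in> path_image \<delta> \<Longrightarrow> corner_vector (g ` {..<m}) z"
    "\<And>z. z \<in> path_image \<delta> \<Longrightarrow> cross3 M z \<noteq> 0"
    using odd_closed_walk_antipodal_path[of m g] assms(4-6) diam by blast
  obtain z w where zw: "z \<in> path_image \<gamma>" "w \<in> path_image \<delta>" "cross3 z w = 0"
    by (rule antipodal_paths_meet[OF \<gamma>(1,2) \<delta>(1,2) \<gamma>(4)])
  have "w \<noteq> 0"
    using corner_vector_nonzero[OF \<delta>(3)[OF zw(2)]] diam by blast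
  moreover have "collinear {0, w, z}" using zw(3) by (simp add: cross_eq_0 insert_commute)
  ultimately obtain k where "z = k *\<^sub>R w"
    by (auto simp: collinear_lemma)
  moreover have "z \<noteq> k *\<^sub>R w"
    using corner_vectors_not_parallel[OF \<gamma>(3)[OF zw(1)] \<delta>(3)[OF zw(2)] disjoint diam] .
  ultimately show False by blast
qed

lemma odd_closed_walks_in_diameter_graph_meet:
  fixes f g :: "nat \<Rightarrow> real^3"
  assumes "0 < D" and "odd n" "f n = f 0" "\<And>i. i < n \<Longrightarrow> dist (f i) (f (Suc i)) = D"
    and "odd m" "g m = g 0" "\<And>i. i < m \<Longrightarrow> dist (g i) (g (Suc i)) = D"
    and diam: "\<And>x y. x \<in> f ` {..<n} \<union> g ` {..<m} \<Longrightarrow> y \<in> f ` {..<n} \<union> g ` {..<m} \<Longrightarrow> dist x y \<le> D"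
  shows "f ` {..<n} \<inter> g ` {..<m} \<noteq> {}"
proof -
  define s :: "real^3 \<Rightarrow> real^3" where "s = (\<lambda>x. (1 / D) *\<^sub>R x)"
  have dist_s: "dist (s x) (s y) = dist x y / D" for x y
    using \<open>0 < D\<close> by (simp add: s_def dist_norm flip: scaleR_diff_right)
  have "inj s" using \<open>0 < D\<close> by (auto simp: s_def inj_def)
  have "(\<lambda>i. s (f i)) ` {..<n} \<inter> (\<lambda>i. s (g i)) ` {..<m} \<noteq> {}"
    using assms by (intro odd_closed_walks_meet_unit) (auto simp: dist_s)
  then show ?thesis using \<open>inj s\<close> by (auto simp: inj_def)
qed

section \<open>Eight points with at most four distances\<close>

lemma diameter_graph_independent_set:
  fixes S :: "(real^3) set"
  assumes S: "finite S" "card S = 20" and "0 < D"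
    and diam: "\<And>x y. x \<in> S \<Longrightarrow> y \<in> S \<Longrightarrow> dist x y \<le> D"
  obtains I where "I \<subseteq> S" "8 \<le> card I" "independent_set (\<lambda>x y. dist x y = D) I"
proof (cases "\<exists>n f. odd n \<and> n \<le> 5 \<and> f n = f 0 \<and> f ` {..<n} \<subseteq> S \<and> (\<forall>i<n. dist (f i) (f (Suc i)) = D)")
  case True
  then obtain n and f :: "nat \<Rightarrow> real^3" where f: "odd n" "n \<le> 5" "f n = f 0" "f ` {..<n} \<subseteq> S"
    "\<forall>i<n. dist (f i) (f (Suc i)) = D" by auto
  define T where "T = S - f ` {..<n}"
  have "card (f ` {..<n}) \<le> 5"
    using card_image_le[of "{..<n}" f] f(2) by simp
  then have "15 \<le> card T"
    unfolding T_def using S diff_card_le_card_Diff[of "f ` {..<n}" S] by simp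
  have noodd: "(x, x) \<notin> {(x, y). x \<in> T \<and> y \<in> T \<and> dist x y = D} ^^ m" if "odd m" for x m
  proof
    assume "(x, x) \<in> {(x, y). x \<in> T \<and> y \<in> T \<and> dist x y = D} ^^ m"
    then obtain g where g: "g 0 = x" "g m = x"
      "\<And>i. i < m \<Longrightarrow> g i \<in> T \<and> g (Suc i) \<in> T \<and> dist (g i) (g (Suc i)) = D"
      unfolding relpow_fun_conv by auto
    have sub: "f ` {..<n} \<union> g ` {..<m} \<subseteq> S" using f(4) g(3) by (auto simp: T_def)
    have "f ` {..<n} \<inter> g ` {..<m} \<noteq> {}"
      by (rule odd_closed_walks_in_diameter_graph_meet[of D])
        (use \<open>0 < D\<close> f g that diam subsetD[OF sub] in simp_all)
    then obtain y where y: "y \<in> f ` {..<n}" "y \<in> g ` {..<m}" by blast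
    from y(2) obtain i where "i < m" "y = g i" by (rule imageE) simp
    then have "y \<in> T" using g(3)[of i] by simp
    then show False using y(1) by (simp add: T_def)
  qed
  obtain I where I: "I \<subseteq> T" "independent_set (\<lambda>x y. dist x y = D) I" "card T \<le> 2 * card I"
    by (rule large_independent_set_if_no_odd_closed_walk[of T "\<lambda>x y. dist x y = D"])
      (use S noodd in \<open>auto simp: T_def dist_commute\<close>)
  show ?thesis
  proof (rule that[OF _ _ I(2)])
    show "I \<subseteq> S" using I(1) by (auto simp: T_def)
    show "8 \<le> card I" using I(3) \<open>15 \<le> card T\<close> by linarith
  qed
next
  case False
  have no_walk: False if "odd (length xs)" "length xs \<le> 5" "set xs \<subseteq> S"
    "\<forall>i<length xs. dist ((xs @ [hd xs]) ! i) ((xs @ [hd xs]) ! Suc i) = D" for xs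
  proof -
    define f where "f = (\<lambda>i. (xs @ [hd xs]) ! i)"
    have "xs \<noteq> []" using that(1) by auto
    then have "f (length xs) = f 0" by (auto simp: f_def nth_append hd_conv_nth)
    moreover have "f ` {..<length xs} \<subseteq> S" using that(3) by (auto simp: f_def nth_append)
    moreover have "\<forall>i<length xs. dist (f i) (f (Suc i)) = D" using that(4) by (simp add: f_def)
    ultimately show False using False that(1,2) by blast
  qed
  define E where "E = (\<lambda>x y. x \<in> S \<and> y \<in> S \<and> dist x y = D)"
  interpret odd_girth_over_five E
  proof
    show "E y x" if "E x y" for x y using that by (auto simp: E_def dist_commute)
    show False if "E x y" "E y z" "E z x" for x y z
      using no_walk[of "[x, y, z]"] that by (auto simp: E_def less_Suc_eq)
    show False if "E u v" "E v w" "E w x" "E x y" "E y u" for u v w x y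
      using no_walk[of "[u, v, w, x, y]"] that by (auto simp: E_def less_Suc_eq)
  qed
  obtain I where I: "I \<subseteq> S" "8 \<le> card I" "independent_set E I"
    using indep_boundD[OF indep_bound_20, of S] S unfolding has_indep_def by auto
  have "independent_set (\<lambda>x y. dist x y = D) I"
    using I(1,3) unfolding independent_set_def E_def by blast
  with I(1,2) show ?thesis by (rule that)
qed

theorem theorem1p3:
  fixes X :: "(real ^ 3) set"
  assumes "s_distance_set 5 X"
    and "infinite X \<or> card X \<ge> 20"
  shows "\<exists>Y \<subseteq> X. finite Y \<and> card Y = 8 \<and> (\<exists>s \<le> 4. s_distance_set s Y)"
proof -
  have distX: "finite (distances X)" "card (distances X) = 5"
    using assms(1) by (auto simp: s_distance_set_def)
  obtain S where S: "S \<subseteq> X" "finite S" "card S = 20"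
    using assms(2) by (metis infinite_arbitrarily_large obtain_subset_with_card_n)
  have sub: "distances A \<subseteq> distances B" if "A \<subseteq> B" for A B :: "(real^3) set"
    using that unfolding distances_def by blast
  have "\<not> S \<subseteq> {x}" for x
    using S(3) card_mono[of "{x}" S] by auto
  then obtain x y where "x \<in> S" "y \<in> S" "x \<noteq> y" by blast
  then have ne: "distances S \<noteq> {}" unfolding distances_def by blast
  have finS: "finite (distances S)" using sub[OF S(1)] distX finite_subset by blast
  define D where "D = Max (distances S)"
  have D: "D \<in> distances S" unfolding D_def using finS ne by (rule Max_in)
  then have "0 < D" by (auto simp: distances_def)
  have diam: "dist x y \<le> D" if "x \<in> S" "y \<in> S" for x y
  proof (cases "x = y")
    case False
    then have "dist x y \<in> distances S" using that unfolding distances_def by blast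
    then show ?thesis unfolding D_def using finS by simp
  qed (use \<open>0 < D\<close> in simp)
  obtain I where I: "I \<subseteq> S" "8 \<le> card I" "independent_set (\<lambda>x y. dist x y = D) I"
    using diameter_graph_independent_set[OF S(2,3) \<open>0 < D\<close> diam] by blast
  obtain Y where Y: "Y \<subseteq> I" "card Y = 8" "finite Y"
    using I(2) by (meson obtain_subset_with_card_n)
  have "D \<notin> distances Y"
    using I(3) Y(1) unfolding distances_def independent_set_def by blast
  then have "distances Y \<subseteq> distances X - {D}"
    using sub[of Y X] I(1) Y(1) S(1) by blast
  moreover have "card (distances X - {D}) = 4"
    using D sub[OF S(1)] distX by auto
  ultimately have "finite (distances Y)" "card (distances Y) \<le> 4"
    using distX(1) by (metis finite_Diff finite_subset, metis card_mono finite_Diff)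
  then show ?thesis using Y I(1) S(1)
    by (intro exI[of _ Y]) (auto simp: s_distance_set_def)
qed

end
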